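(* Every matrix $B\in\mathcal{B}_{R_8}$ is reducible with respect to $R_8$, where $$R_8=\frac12\begin{bmatrix} J&O&O&Y \\ Y&J&O&O \\ O&Y&J&O \\ O&O&Y&J \end{bmatrix}$$ and $J$, $O$, $Y=2I-J$ are square matrices of order $2$.
   Context: $I$ is the identity matrix, $J$ the all-ones matrix and $O$ the zero matrix. An adjacency matrix is a symmetric $01$-matrix with zero diagonal. An orthogonal matrix is regular if each of its rows sums to $1$. The level of a rational matrix is the smallest positive integer $\ell$ such that $\ell$ times the matrix is integral. A matrix is decomposable if it can be written as a non-trivial block-diagonal matrix after some permutation of its rows and columns (rows and columns may be permuted independently), and indecomposable otherwise. For a regular orthogonal matrix $R$, $\mathcal{V}_R$ is the set of $01$-vectors $v$ such that $R^Tv$ is again a $01$-vector, and $\mathcal{B}_R$ is the set of adjacency matrices $B$ such that $R^TBR$ is again an adjacency matrix. Reducibility: let $R$ be an indecomposable regular orthogonal matrix of level $2$ and let $B\in\mathcal{B}_R$. Then $B$ is reducible with respect to $R$ if there are decomposable regular orthogonal matrices $R_1,\dots,R_s$ of the same order as $R$, each of level at most $2$ (in particular $R_i$ may have the form $\mathrm{diag}(R_i',I)$ with $R_i'$ a smaller regular orthogonal matrix, and may have several non-trivial blocks), such that $R=R_1\cdots R_s$ and such that for every $i<s$ and every adjacency matrix $A=\begin{bmatrix} B&V \\ V^T&W \end{bmatrix}$ all of whose columns of $V$ lie in $\mathcal{V}_R$, the matrix $(Q_1\cdots Q_i)^TA(Q_1\cdots Q_i)$ is an adjacency matrix, where $Q_k=\begin{bmatrix}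 R_k&O \\ O&I \end{bmatrix}$. *)

theory Defs
  imports "Jordan_Normal_Form.Matrix" "HOL-Combinatorics.Permutations"
begin

definition adjacency_matrix :: "rat mat \<Rightarrow> bool" where
  "adjacency_matrix A \<longleftrightarrow> square_mat A \<and> transpose_mat A = A \<and> elements_mat A \<subseteq> {0, 1} \<and>
     (\<forall>i < dim_row A. A $$ (i, i) = 0)"

text \<open>The library predicate \<^term>\<open>orthogonal_mat\<close> only asks for pairwise orthogonal nonzero columns,
  not for orthonormal ones, hence it is not used here.\<close>

definition regular_orthogonal :: "rat mat \<Rightarrow> bool" where
  "regular_orthogonal R \<longleftrightarrow> square_mat R \<and> transpose_mat R * R = 1\<^sub>m (dim_row R) \<and>
     (\<forall>i < dim_row R. (\<Sum>j < dim_col R. R $$ (i, j)) = 1)"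

definition level :: "rat mat \<Rightarrow> nat" where
  "level M = (LEAST l. l > 0 \<and> elements_mat (of_nat l \<cdot>\<^sub>m M) \<subseteq> \<int>)"

text \<open>Rows and columns are permuted independently. The diagonal blocks are square and nonempty;
  for an invertible matrix, rectangular diagonal blocks are necessarily square anyway.\<close>

definition decomposable :: "rat mat \<Rightarrow> bool" where
  "decomposable M \<longleftrightarrow> square_mat M \<and>
     (\<exists>p q k C D. p permutes {..<dim_row M} \<and> q permutes {..<dim_row M} \<and>
        0 < k \<and> k < dim_row M \<and>
        C \<in> carrier_mat k k \<and> D \<in> carrier_mat (dim_row M - k) (dim_row M - k) \<and>
        mat (dim_row M) (dim_row M) (\<lambda>(i, j). M $$ (p i, q j)) =
          four_block_mat C (0\<^sub>m k (dim_row M - k)) (0\<^sub>m (dim_row M - k) k) D)"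

definition V_set :: "rat mat \<Rightarrow> rat vec set" where
  "V_set R = {v \<in> carrier_vec (dim_row R).
     set\<^sub>v v \<subseteq> {0, 1} \<and> set\<^sub>v (transpose_mat R *\<^sub>v v) \<subseteq> {0, 1}}"

definition B_set :: "rat mat \<Rightarrow> rat mat set" where
  "B_set R = {B \<in> carrier_mat (dim_row R) (dim_row R).
     adjacency_matrix B \<and> adjacency_matrix (transpose_mat R * B * R)}"

definition mat_prod :: "nat \<Rightarrow> rat mat list \<Rightarrow> rat mat" where
  "mat_prod n Ms = foldr (*) Ms (1\<^sub>m n)"

definition extend_id :: "nat \<Rightarrow> rat mat \<Rightarrow> rat mat" where
  "extend_id m R = four_block_mat R (0\<^sub>m (dim_row R) m) (0\<^sub>m m (dim_col R)) (1\<^sub>m m)"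

text \<open>The notion is only meaningful for an indecomposable regular orthogonal \<open>R\<close> of level 2 and for
  \<open>B\<close> in \<^term>\<open>B_set R\<close>, so these requirements are part of the definition. The list \<open>Rs\<close> is
  \<open>R\<^sub>1, \<dots>, R\<^sub>s\<close>, so that \<open>take i Rs\<close> is \<open>R\<^sub>1, \<dots>, R\<^sub>i\<close>; the order \<open>m\<close> of \<open>W\<close> is arbitrary.\<close>

definition reducible :: "rat mat \<Rightarrow> rat mat \<Rightarrow> bool" where
  "reducible R B \<longleftrightarrow>
     regular_orthogonal R \<and> \<not> decomposable R \<and> level R = 2 \<and> B \<in> B_set R \<and>
     (\<exists>Rs. (\<forall>R' \<in> set Rs. R' \<in> carrier_mat (dim_row R) (dim_row R) \<and>
               regular_orthogonal R' \<and> decomposable R' \<and> level R' \<le> 2) \<and>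
        R = mat_prod (dim_row R) Rs \<and>
        (\<forall>i \<in> {1..<length Rs}. \<forall>m. \<forall>V \<in> carrier_mat (dim_row R) m. \<forall>W \<in> carrier_mat m m.
           let A = four_block_mat B V (transpose_mat V) W;
               Q = mat_prod (dim_row R + m) (map (extend_id m) (take i Rs))
           in adjacency_matrix A \<and> set (cols V) \<subseteq> V_set R \<longrightarrow>
              adjacency_matrix (transpose_mat Q * A * Q)))"

definition J2 :: "rat mat" where
  "J2 = mat 2 2 (\<lambda>_. 1)"

definition Y2 :: "rat mat" where
  "Y2 = 2 \<cdot>\<^sub>m 1\<^sub>m 2 - J2"

definition R8 :: "rat mat" where
  "R8 = (let O2 = 0\<^sub>m 2 2 in
     (1 / 2) \<cdot>\<^sub>m four_block_mat
       (four_block_mat J2 O2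
                       Y2 J2)  (four_block_mat O2 Y2
                                               O2 O2)
       (four_block_mat O2 Y2
                       O2 O2)  (four_block_mat J2 O2
                                               Y2 J2))"

end

theory Submission
  imports Defs
begin

text \<open>Split the eight coordinates into four pairs, and let \<open>e\<^sub>i\<close> and \<open>f\<^sub>i\<close> be the vectors that are
  \<open>(1, 1)\<close> and \<open>(1, -1)\<close> on the \<open>i\<close>-th pair and zero elsewhere. Then \<open>R\<^sub>8\<close> fixes every \<open>e\<^sub>i\<close> and
  permutes the \<open>f\<^sub>i\<close> by a 4-cycle \<open>\<gamma>\<close>. Writing \<open>P\<^sub>\<sigma>\<close> for the matrix that permutes the \<open>f\<^sub>i\<close>
  by \<open>\<sigma>\<close> instead, we have \<open>R\<^sub>8 = P\<^sub>\<sigma> P\<^sub>\<tau>\<close> with \<open>\<tau> = \<sigma> \<gamma>\<close> for every transposition \<open>\<sigma>\<close>; both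
  factors are decomposable because \<open>\<sigma>\<close> and the even permutation \<open>\<tau>\<close> are not 4-cycles. The set
  \<open>V_set R\<^sub>8\<close> consists of the 01-vectors whose four pair sums have the same parity, so it is
  contained in every \<open>V_set P\<^sub>\<sigma>\<close>. It remains to find, for each \<open>B\<close>, a transposition \<open>\<sigma>\<close> with
  \<open>B \<in> B_set P\<^sub>\<sigma>\<close>. In terms of the numbers \<open>e\<^sub>i\<^sup>T B e\<^sub>j\<close>, \<open>e\<^sub>i\<^sup>T B f\<^sub>j\<close>, \<open>f\<^sub>i\<^sup>T B f\<^sub>j\<close> the hypothesis forces
  all of those with \<open>i \<noteq> j\<close> to be even. Then only whether they vanish matters, not their signs, and the
  existence of \<open>\<sigma>\<close> becomes a propositional statement; five of the six transpositions suffice.\<close>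

section \<open>The matrices \<open>P\<^sub>\<sigma>\<close> on n pairs: products, transposes,
  regularity and level\<close>

definition pair_perm_mat :: "nat \<Rightarrow> (nat \<Rightarrow> nat) \<Rightarrow> rat mat" where
  "pair_perm_mat n \<sigma> = mat (2 * n) (2 * n) (\<lambda>(u, v).
     (of_bool (u div 2 = v div 2) + (- 1) ^ (u + v) * of_bool (u div 2 = \<sigma> (v div 2))) / 2)"

definition pair_sum :: "(nat \<Rightarrow> rat) \<Rightarrow> nat \<Rightarrow> rat" where
  "pair_sum g i = g (2 * i) + g (2 * i + 1)"

definition pair_diff :: "(nat \<Rightarrow> rat) \<Rightarrow> nat \<Rightarrow> rat" where
  "pair_diff g i = g (2 * i) - g (2 * i + 1)"

lemma pair_perm_mat_carrier [simp]: "pair_perm_mat n \<sigma> \<in> carrier_mat (2 * n) (2 * n)"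
  by (simp add: pair_perm_mat_def)

lemma pair_perm_mat_dim [simp]:
  "dim_row (pair_perm_mat n \<sigma>) = 2 * n" "dim_col (pair_perm_mat n \<sigma>) = 2 * n"
  by (simp_all add: pair_perm_mat_def)

lemma pair_perm_mat_index:
  assumes "u < 2 * n" "v < 2 * n"
  shows "pair_perm_mat n \<sigma> $$ (u, v) =
    (of_bool (u div 2 = v div 2) + (- 1) ^ (u + v) * of_bool (u div 2 = \<sigma> (v div 2))) / 2"
  using assms by (simp add: pair_perm_mat_def)

lemma sum_pairs: "(\<Sum>u < 2 * n. h u) = (\<Sum>i < n. pair_sum h i)"
  by (induction n) (simp_all add: pair_sum_def algebra_simps)

text \<open>With \<open>i = j div 2\<close>, column j of \<open>P\<^sub>\<sigma>\<close> is half of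
  \<open>e\<^sub>i\<close> plus \<open>(- 1) ^ j\<close> times half of the vector f at
  \<open>\<sigma> i\<close>. Taking the inner product with g turns \<open>e\<close> into
  \<open>pair_sum\<close> and \<open>f\<close> into \<open>pair_diff\<close>.\<close>

lemma sum_pair_perm_mat_col:
  assumes "j < 2 * n" "\<sigma> (j div 2) < n"
  shows "(\<Sum>u < 2 * n. pair_perm_mat n \<sigma> $$ (u, j) * g u) =
    (pair_sum g (j div 2) + (- 1) ^ j * pair_diff g (\<sigma> (j div 2))) / 2"
proof -
  have j: "j div 2 < n"
    using assms(1) by auto
  have "(\<Sum>u < 2 * n. pair_perm_mat n \<sigma> $$ (u, j) * g u) =
      (\<Sum>i < n. (if i = j div 2 then pair_sum g i / 2 else 0)
        + (if i = \<sigma> (j div 2) then (- 1) ^ j * pair_diff g i / 2 else 0))"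
    unfolding sum_pairs
  proof (rule sum.cong)
    fix i assume "i \<in> {..<n}"
    then have "2 * i < 2 * n" "2 * i + 1 < 2 * n"
      by auto
    then show "pair_sum (\<lambda>u. pair_perm_mat n \<sigma> $$ (u, j) * g u) i =
      (if i = j div 2 then pair_sum g i / 2 else 0)
        + (if i = \<sigma> (j div 2) then (- 1) ^ j * pair_diff g i / 2 else 0)"
      using assms(1)
      by (simp add: pair_sum_def pair_diff_def pair_perm_mat_index power_add field_simps del: One_nat_def)
  qed simp
  also have "\<dots> = (pair_sum g (j div 2) + (- 1) ^ j * pair_diff g (\<sigma> (j div 2))) / 2"
    using j assms(2) by (simp add: sum.distrib add_divide_distrib)
  finally show ?thesis .
qed

text \<open>Both factors fix every \<open>e\<^sub>i\<close>, and the vectors f are moved first by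
  \<tau>, then by \<sigma>. In coordinates, this is the column formula applied to a row of
  \<open>P\<^sub>\<sigma>\<close>.\<close>

lemma pair_perm_mat_mult:
  assumes "\<And>i. i < n \<Longrightarrow> \<tau> i < n"
  shows "pair_perm_mat n \<sigma> * pair_perm_mat n \<tau> = pair_perm_mat n (\<sigma> \<circ> \<tau>)"
proof (rule eq_matI)
  fix u v assume "u < dim_row (pair_perm_mat n (\<sigma> \<circ> \<tau>))" "v < dim_col (pair_perm_mat n (\<sigma> \<circ> \<tau>))"
  then have uv: "u < 2 * n" "v < 2 * n"
    by auto
  let ?g = "\<lambda>w. pair_perm_mat n \<sigma> $$ (u, w)"
  have v: "v div 2 < n"
    using uv by auto
  have "(pair_perm_mat n \<sigma> * pair_perm_mat n \<tau>) $$ (u, v) =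
      (\<Sum>w < 2 * n. pair_perm_mat n \<tau> $$ (w, v) * ?g w)"
    using uv by (simp add: scalar_prod_def lessThan_atLeast0 mult.commute)
  also have "\<dots> = (pair_sum ?g (v div 2) + (- 1) ^ v * pair_diff ?g (\<tau> (v div 2))) / 2"
    using uv v assms by (intro sum_pair_perm_mat_col) auto
  also have "pair_sum ?g (v div 2) = of_bool (u div 2 = v div 2)"
    using uv v by (simp add: pair_sum_def pair_perm_mat_index field_simps)
  also have "pair_diff ?g (\<tau> (v div 2)) = (- 1) ^ u * of_bool (u div 2 = \<sigma> (\<tau> (v div 2)))"
    using uv assms[OF v] by (cases "even u") (simp_all add: pair_diff_def pair_perm_mat_index)
  finally show "(pair_perm_mat n \<sigma> * pair_perm_mat n \<tau>) $$ (u, v) =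
      pair_perm_mat n (\<sigma> \<circ> \<tau>) $$ (u, v)"
    using uv by (simp add: pair_perm_mat_index power_add)
qed auto

lemma pair_perm_mat_id: "pair_perm_mat n id = 1\<^sub>m (2 * n)"
proof (rule eq_matI)
  fix u v assume "u < dim_row (1\<^sub>m (2 * n) :: rat mat)" "v < dim_col (1\<^sub>m (2 * n) :: rat mat)"
  moreover have "u = v \<longleftrightarrow> u div 2 = v div 2 \<and> even (u + v)"
    by presburger
  ultimately show "pair_perm_mat n id $$ (u, v) = 1\<^sub>m (2 * n) $$ (u, v)"
    by (auto simp: pair_perm_mat_index)
qed auto

lemma transpose_pair_perm_mat:
  assumes "\<sigma> permutes {..<n}"
  shows "transpose_mat (pair_perm_mat n \<sigma>) = pair_perm_mat n (inv_into UNIV \<sigma>)"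
proof (rule eq_matI)
  fix u v assume "u < dim_row (pair_perm_mat n (inv_into UNIV \<sigma>))" "v < dim_col (pair_perm_mat n (inv_into UNIV \<sigma>))"
  moreover have "v div 2 = \<sigma> (u div 2) \<longleftrightarrow> u div 2 = inv_into UNIV \<sigma> (v div 2)"
    using permutes_inverses[OF assms] by metis
  ultimately show "transpose_mat (pair_perm_mat n \<sigma>) $$ (u, v) = pair_perm_mat n (inv_into UNIV \<sigma>) $$ (u, v)"
    by (auto simp: pair_perm_mat_index add.commute)
qed auto

lemma regular_orthogonal_pair_perm_mat:
  assumes "\<sigma> permutes {..<n}"
  shows "regular_orthogonal (pair_perm_mat n \<sigma>)"
  unfolding regular_orthogonal_def
proof (intro conjI allI impI)
  show "square_mat (pair_perm_mat n \<sigma>)"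
    by simp
  have lt: "i < n \<Longrightarrow> \<sigma> i < n" "i < n \<Longrightarrow> inv_into UNIV \<sigma> i < n" for i
    using permutes_in_image[OF assms] permutes_in_image[OF permutes_inv[OF assms]] by auto
  show "transpose_mat (pair_perm_mat n \<sigma>) * pair_perm_mat n \<sigma> = 1\<^sub>m (dim_row (pair_perm_mat n \<sigma>))"
    using lt permutes_inv_o(2)[OF assms]
    by (simp add: transpose_pair_perm_mat[OF assms] pair_perm_mat_mult pair_perm_mat_id)
  fix u assume "u < dim_row (pair_perm_mat n \<sigma>)"
  then have u: "u < 2 * n" "u div 2 < n"
    by auto
  \<comment> \<open>Row sums are column sums of the transpose, which is the matrix of the inverse
    permutation. The column formula with the constant function 1 then has vanishing
    \<open>pair_diff\<close>.\<close>
  have "(\<Sum>v < 2 * n. pair_perm_mat n \<sigma> $$ (u, v)) =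
      (\<Sum>v < 2 * n. pair_perm_mat n (inv_into UNIV \<sigma>) $$ (v, u) * 1)"
    using u by (intro sum.cong) (auto simp flip: transpose_pair_perm_mat[OF assms])
  also have "\<dots> = 1"
    using u lt by (subst sum_pair_perm_mat_col) (auto simp: pair_sum_def pair_diff_def)
  finally show "(\<Sum>v < dim_col (pair_perm_mat n \<sigma>). pair_perm_mat n \<sigma> $$ (u, v)) = 1"
    by simp
qed

lemma elements_double_pair_perm_mat: "elements_mat (of_nat 2 \<cdot>\<^sub>m pair_perm_mat n \<sigma>) \<subseteq> \<int>"
proof -
  have "2 * pair_perm_mat n \<sigma> $$ (u, v) \<in> \<int>" if "u < 2 * n" "v < 2 * n" for u v
    using that by (cases "even (u + v)") (simp_all add: pair_perm_mat_index)
  then show ?thesis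
    by (auto simp: elements_mat_def)
qed

lemma level_pair_perm_mat_le: "level (pair_perm_mat n \<sigma>) \<le> 2"
  unfolding level_def using elements_double_pair_perm_mat by (intro Least_le) simp

section \<open>Decomposability from invariant sets of indices\<close>

lemma decomposable_if_closed:
  assumes M: "M \<in> carrier_mat n n" and S: "S \<subset> {..<n}" "S \<noteq> {}"
    and zero: "\<And>i j. i < n \<Longrightarrow> j < n \<Longrightarrow> i \<in> S \<longleftrightarrow> j \<notin> S \<Longrightarrow> M $$ (i, j) = 0"
  shows "decomposable M"
proof -
  define k where "k = card S"
  have fin: "finite S"
    using S finite_subset by blast
  have k: "0 < k" "k < n"
    using S fin psubset_card_mono[of "{..<n}" S] by (auto simp: k_def card_gt_0_iff)
  obtain f where f: "bij_betw f {..<k} S"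
    using fin ex_bij_betw_nat_finite[of S] by (auto simp: k_def lessThan_atLeast0)
  have "card {k..<n} = card ({..<n} - S)"
    using S fin by (simp add: k_def card_Diff_subset psubset_imp_subset)
  then obtain g where g: "bij_betw g {k..<n} ({..<n} - S)"
    by (metis finite_Diff finite_atLeastLessThan finite_lessThan finite_same_card_bij)
  \<comment> \<open>The same relabelling serves rows and columns: it lists S first, then the
    complement of S. Being the identity from n on makes it a permutation of
    \<open>{..<n}\<close>.\<close>
  define p where "p i = (if i < k then f i else if i < n then g i else i)" for i
  have pS: "p i \<in> S \<longleftrightarrow> i < k" "p i < n" if "i < n" for i
    using that S bij_betwE[OF f] bij_betwE[OF g] by (auto simp: p_def)
  have "bij_betw p ({..<k} \<union> {k..<n}) (S \<union> ({..<n} - S))"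
  proof (rule bij_betw_combine)
    show "bij_betw p {..<k} S"
      using f by (subst bij_betw_cong[where g = f]) (auto simp: p_def)
    show "bij_betw p {k..<n} ({..<n} - S)"
      using g by (subst bij_betw_cong[where g = g]) (auto simp: p_def)
  qed auto
  moreover have "{..<k} \<union> {k..<n} = {..<n}" "S \<union> ({..<n} - S) = {..<n}"
    using k S by auto
  ultimately have p: "p permutes {..<n}"
    using k by (intro bij_imp_permutes) (auto simp: p_def)
  let ?C = "mat k k (\<lambda>(i, j). M $$ (p i, p j))"
  let ?D = "mat (n - k) (n - k) (\<lambda>(i, j). M $$ (p (i + k), p (j + k)))"
  have "mat n n (\<lambda>(i, j). M $$ (p i, p j)) =
      four_block_mat ?C (0\<^sub>m k (n - k)) (0\<^sub>m (n - k) k) ?D"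
    using k by (intro eq_matI) (auto simp: zero pS)
  moreover have "?C \<in> carrier_mat k k" "?D \<in> carrier_mat (n - k) (n - k)"
    by auto
  ultimately show ?thesis
    using M p k unfolding decomposable_def
    by (metis carrier_matD(1) carrier_matD(2) square_mat.simps)
qed

lemma decomposable_pair_perm_mat:
  assumes S: "S \<subset> {..<n}" "S \<noteq> {}" and inv: "\<And>i. i < n \<Longrightarrow> \<sigma> i \<in> S \<longleftrightarrow> i \<in> S"
  shows "decomposable (pair_perm_mat n \<sigma>)"
proof (rule decomposable_if_closed)
  let ?T = "{u. u < 2 * n \<and> u div 2 \<in> S}"
  show "pair_perm_mat n \<sigma> \<in> carrier_mat (2 * n) (2 * n)"
    by simp
  from S obtain i j where "i \<in> S" "j \<notin> S" "i < n" "j < n"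
    by blast
  then have "2 * i \<in> ?T" "2 * j \<in> {..<2 * n} - ?T"
    by auto
  then show "?T \<noteq> {}" "?T \<subset> {..<2 * n}"
    by blast+
  fix u v assume uv: "u < 2 * n" "v < 2 * n" "u \<in> ?T \<longleftrightarrow> v \<notin> ?T"
  then have "v div 2 < n"
    by auto
  then show "pair_perm_mat n \<sigma> $$ (u, v) = 0"
    using uv inv[of "v div 2"] by (auto simp: pair_perm_mat_index)
qed

text \<open>The orbit of d is an invariant set with one or two elements, hence a proper subset of
  \<open>{..<n}\<close>. A fixed point d is included.\<close>

lemma decomposable_pair_perm_mat_if_two_cycle:
  assumes \<sigma>: "\<sigma> permutes {..<n}" and d: "d < n" "\<sigma> (\<sigma> d) = d" and n: "2 < n"
  shows "decomposable (pair_perm_mat n \<sigma>)"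
proof (rule decomposable_pair_perm_mat)
  have "card {d, \<sigma> d} \<le> 2"
    by (simp add: card_insert_if)
  then have "{d, \<sigma> d} \<noteq> {..<n}"
    using n by (metis card_lessThan not_le)
  then show "{d, \<sigma> d} \<subset> {..<n}"
    using permutes_in_image[OF \<sigma>, of d] d by auto
  show "\<sigma> i \<in> {d, \<sigma> d} \<longleftrightarrow> i \<in> {d, \<sigma> d}" for i
    using d(2) permutes_inj[OF \<sigma>] by (metis injD insert_iff singletonD)
qed simp

section \<open>Membership in \<open>V_set\<close> and \<open>B_set\<close> of
  \<open>P\<^sub>\<sigma>\<close> through pair sums and differences\<close>

lemma adjacency_matrix_iff:
  assumes "A \<in> carrier_mat n n"
  shows "adjacency_matrix A \<longleftrightarrow>
    (\<forall>i < n. \<forall>j < n. A $$ (i, j) \<in> {0, 1} \<and> A $$ (j, i) = A $$ (i, j)) \<and> (\<forall>i < n. A $$ (i, i) = 0)"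
proof -
  have "transpose_mat A = A \<longleftrightarrow> (\<forall>i < n. \<forall>j < n. A $$ (j, i) = A $$ (i, j))"
    using assms by (auto simp: mat_eq_iff)
  moreover have "elements_mat A \<subseteq> {0, 1} \<longleftrightarrow> (\<forall>i < n. \<forall>j < n. A $$ (i, j) \<in> {0, 1})"
    using assms unfolding elements_mat_def by fastforce
  moreover have "square_mat A" "dim_row A = n"
    using assms by auto
  ultimately show ?thesis
    unfolding adjacency_matrix_def by blast
qed

lemma pair_perm_mat_transpose_mult_index:
  assumes "M \<in> carrier_mat (2 * n) m" "u < 2 * n" "v < m" "\<sigma> (u div 2) < n"
  shows "(transpose_mat (pair_perm_mat n \<sigma>) * M) $$ (u, v) =
    (pair_sum (\<lambda>w. M $$ (w, v)) (u div 2) + (- 1) ^ u * pair_diff (\<lambda>w. M $$ (w, v)) (\<sigma> (u div 2))) / 2"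
  using assms
  by (simp add: scalar_prod_def sum_pair_perm_mat_col flip: lessThan_atLeast0)

lemma mult_pair_perm_mat_index:
  assumes "M \<in> carrier_mat m (2 * n)" "u < m" "v < 2 * n" "\<sigma> (v div 2) < n"
  shows "(M * pair_perm_mat n \<sigma>) $$ (u, v) =
    (pair_sum (\<lambda>w. M $$ (u, w)) (v div 2) + (- 1) ^ v * pair_diff (\<lambda>w. M $$ (u, w)) (\<sigma> (v div 2))) / 2"
proof -
  have "(M * pair_perm_mat n \<sigma>) $$ (u, v) = (\<Sum>w < 2 * n. pair_perm_mat n \<sigma> $$ (w, v) * M $$ (u, w))"
    using assms by (simp add: scalar_prod_def lessThan_atLeast0 mult.commute)
  with assms show ?thesis
    by (simp add: sum_pair_perm_mat_col)
qed

text \<open>For a sum of two 01-values, being 1 means being odd. Integrality of the halves forces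
  equal parities. Conversely, if both sums are odd, then \<open>a + b = 1\<close> and
  \<open>c - d\<close> is 1 or -1; if both are even, then \<open>c = d\<close> and
  \<open>a + b\<close> is 0 or 2.\<close>

lemma zero_one_half_iff:
  fixes a b c d :: rat
  assumes "a \<in> {0, 1}" "b \<in> {0, 1}" "c \<in> {0, 1}" "d \<in> {0, 1}"
  shows "((a + b) + (c - d)) / 2 \<in> {0, 1} \<and> ((a + b) + (d - c)) / 2 \<in> {0, 1} \<longleftrightarrow>
    (a + b = 1 \<longleftrightarrow> c + d = 1)"
  using assms by auto

lemma all_less_double_iff: "(\<forall>u < 2 * n. P u) \<longleftrightarrow> (\<forall>i < n. P (2 * i) \<and> P (2 * i + 1))" for n :: nat
proof safe
  fix u assume "\<forall>i < n. P (2 * i) \<and> P (2 * i + 1)" "u < 2 * n"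
  then have "P (2 * (u div 2))" "P (2 * (u div 2) + 1)"
    by auto
  then show "P u"
    by (cases "even u") simp_all
qed auto

lemma V_set_pair_perm_mat_iff:
  assumes v: "v \<in> carrier_vec (2 * n)" "set\<^sub>v v \<subseteq> {0, 1}" and \<sigma>: "\<And>i. i < n \<Longrightarrow> \<sigma> i < n"
  shows "v \<in> V_set (pair_perm_mat n \<sigma>) \<longleftrightarrow>
    (\<forall>i < n. pair_sum (($) v) i = 1 \<longleftrightarrow> pair_sum (($) v) (\<sigma> i) = 1)"
proof -
  let ?w = "transpose_mat (pair_perm_mat n \<sigma>) *\<^sub>v v"
  have v01: "v $ i \<in> {0, 1}" if "i < 2 * n" for i
    using v that by (auto simp: vec_set_def)
  have w: "?w $ u = (pair_sum (($) v) (u div 2) + (- 1) ^ u * pair_diff (($) v) (\<sigma> (u div 2))) / 2"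
    if "u < 2 * n" for u
  proof -
    have "u div 2 < n"
      using that by auto
    then show ?thesis
      using that v \<sigma> by (simp add: scalar_prod_def sum_pair_perm_mat_col flip: lessThan_atLeast0)
  qed
  have "v \<in> V_set (pair_perm_mat n \<sigma>) \<longleftrightarrow> (\<forall>u < 2 * n. ?w $ u \<in> {0, 1})"
    using v unfolding V_set_def by (force simp: vec_set_def)
  also have "\<dots> \<longleftrightarrow> (\<forall>i < n. ?w $ (2 * i) \<in> {0, 1} \<and> ?w $ (2 * i + 1) \<in> {0, 1})"
    by (rule all_less_double_iff)
  also have "\<dots> \<longleftrightarrow> (\<forall>i < n. pair_sum (($) v) i = 1 \<longleftrightarrow> pair_sum (($) v) (\<sigma> i) = 1)"
  proof (intro all_cong)
    fix i assume i: "i < n"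
    then have 1: "2 * i < 2 * n" "2 * i + 1 < 2 * n" "2 * \<sigma> i < 2 * n" "2 * \<sigma> i + 1 < 2 * n"
      using \<sigma>[OF i] by auto
    have div: "2 * i div 2 = i" "(2 * i + 1) div 2 = i"
      by auto
    show "(?w $ (2 * i) \<in> {0, 1} \<and> ?w $ (2 * i + 1) \<in> {0, 1}) =
        (pair_sum (($) v) i = 1 \<longleftrightarrow> pair_sum (($) v) (\<sigma> i) = 1)"
      unfolding w[OF 1(1)] w[OF 1(2)] div
      using zero_one_half_iff[OF v01[OF 1(1)] v01[OF 1(2)] v01[OF 1(3)] v01[OF 1(4)]]
      by (simp add: pair_sum_def pair_diff_def power_add power_mult del: One_nat_def)
  qed
  finally show ?thesis .
qed

text \<open>The arguments stand for \<open>e\<^sup>T M e\<close>, \<open>e\<^sup>T M f\<close>, \<open>f\<^sup>T M e\<close>, \<open>f\<^sup>T M f\<close> of a 2 by 2 block \<open>M\<close>, where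
  \<open>e = (1, 1)\<close> and \<open>f = (1, -1)\<close>; the four signed sums are 4 times the entries of \<open>M\<close>.\<close>

definition zero_one_block :: "rat \<Rightarrow> rat \<Rightarrow> rat \<Rightarrow> rat \<Rightarrow> bool" where
  "zero_one_block s c r t \<longleftrightarrow>
    (\<forall>x \<in> {1, - 1}. \<forall>y \<in> {1, - 1}. s + y * c + x * r + x * y * t \<in> {0, 4})"

text \<open>The arguments s, c, t stand for the values of B on pairs (e, e), (e, f), (f, f); by
  symmetry of B, the value on \<open>(f\<^sub>i, e\<^sub>j)\<close> is \<open>c j i\<close>.
  Conjugation by \<open>P\<^sub>\<sigma>\<close> keeps each e and moves the index of each f by
  \<sigma>. The last line is the zero diagonal: the two diagonal entries of block (i, i) are a
  quarter of \<open>s + t + 2 * c\<close> and of \<open>s + t - 2 * c\<close>.\<close>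

definition switchable ::
    "nat \<Rightarrow> (nat \<Rightarrow> nat \<Rightarrow> rat) \<Rightarrow> (nat \<Rightarrow> nat \<Rightarrow> rat) \<Rightarrow> (nat \<Rightarrow> nat \<Rightarrow> rat) \<Rightarrow> (nat \<Rightarrow> nat) \<Rightarrow> bool" where
  "switchable n s c t \<sigma> \<longleftrightarrow>
    (\<forall>i < n. \<forall>j < n. zero_one_block (s i j) (c i (\<sigma> j)) (c j (\<sigma> i)) (t (\<sigma> i) (\<sigma> j))) \<and>
    (\<forall>i < n. s i i + t (\<sigma> i) (\<sigma> i) = 0 \<and> c i (\<sigma> i) = 0)"

definition sum_sum :: "rat mat \<Rightarrow> nat \<Rightarrow> nat \<Rightarrow> rat" where
  "sum_sum B i j = pair_sum (\<lambda>u. pair_sum (\<lambda>v. B $$ (u, v)) j) i"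

definition sum_diff :: "rat mat \<Rightarrow> nat \<Rightarrow> nat \<Rightarrow> rat" where
  "sum_diff B i j = pair_sum (\<lambda>u. pair_diff (\<lambda>v. B $$ (u, v)) j) i"

definition diff_diff :: "rat mat \<Rightarrow> nat \<Rightarrow> nat \<Rightarrow> rat" where
  "diff_diff B i j = pair_diff (\<lambda>u. pair_diff (\<lambda>v. B $$ (u, v)) j) i"

lemma block_sums_symmetric:
  assumes B: "B \<in> carrier_mat (2 * n) (2 * n)" "adjacency_matrix B" and "i < n" "j < n"
  shows "sum_sum B i j = sum_sum B j i" "diff_diff B i j = diff_diff B j i"
    "pair_diff (\<lambda>u. pair_sum (\<lambda>v. B $$ (u, v)) j) i = sum_diff B j i"
proof -
  have sym: "B $$ (v, u) = B $$ (u, v)" if "u < 2 * n" "v < 2 * n" for u v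
    using B that by (simp add: adjacency_matrix_iff)
  show "sum_sum B i j = sum_sum B j i" "diff_diff B i j = diff_diff B j i"
    "pair_diff (\<lambda>u. pair_sum (\<lambda>v. B $$ (u, v)) j) i = sum_diff B j i"
    using assms(3,4)
    by (simp_all add: sum_sum_def diff_diff_def sum_diff_def pair_sum_def pair_diff_def
      sym[of "2 * i" "2 * j"] sym[of "2 * i" "Suc (2 * j)"] sym[of "Suc (2 * i)" "2 * j"]
      sym[of "Suc (2 * i)" "Suc (2 * j)"])
qed

text \<open>The entry is the bilinear form of B at columns u and v of
  \<open>P\<^sub>\<sigma>\<close>, each half of a vector e plus or minus a vector f. Expanding gives
  the four terms; symmetry of B rewrites the (f, e) term as a \<open>sum_diff\<close>.\<close>

lemma pair_perm_mat_conj_index: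
  assumes B: "B \<in> carrier_mat (2 * n) (2 * n)" "adjacency_matrix B"
    and \<sigma>: "\<And>i. i < n \<Longrightarrow> \<sigma> i < n" and uv: "u < 2 * n" "v < 2 * n"
  shows "(transpose_mat (pair_perm_mat n \<sigma>) * B * pair_perm_mat n \<sigma>) $$ (u, v) =
    (sum_sum B (u div 2) (v div 2) + (- 1) ^ v * sum_diff B (u div 2) (\<sigma> (v div 2))
      + (- 1) ^ u * sum_diff B (v div 2) (\<sigma> (u div 2))
      + (- 1) ^ u * (- 1) ^ v * diff_diff B (\<sigma> (u div 2)) (\<sigma> (v div 2))) / 4"
proof -
  let ?P = "pair_perm_mat n \<sigma>"
  have lt: "u div 2 < n" "v div 2 < n"
    using uv by auto
  have row: "(transpose_mat ?P * B) $$ (u, w) =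
      (pair_sum (\<lambda>x. B $$ (x, w)) (u div 2) + (- 1) ^ u * pair_diff (\<lambda>x. B $$ (x, w)) (\<sigma> (u div 2))) / 2"
    if "w < 2 * n" for w
    using pair_perm_mat_transpose_mult_index[OF B(1) uv(1) that] \<sigma> lt by simp
  let ?N = "transpose_mat ?P * B"
  have N: "?N \<in> carrier_mat (2 * n) (2 * n)"
    using B by (intro mult_carrier_mat) auto
  have row_pair:
    "?N $$ (u, 2 * j) = (pair_sum (\<lambda>x. B $$ (x, 2 * j)) (u div 2)
      + (- 1) ^ u * pair_diff (\<lambda>x. B $$ (x, 2 * j)) (\<sigma> (u div 2))) / 2"
    "?N $$ (u, 2 * j + 1) = (pair_sum (\<lambda>x. B $$ (x, 2 * j + 1)) (u div 2)
      + (- 1) ^ u * pair_diff (\<lambda>x. B $$ (x, 2 * j + 1)) (\<sigma> (u div 2))) / 2"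
    if "j < n" for j
    using that by (intro row; simp)+
  have sum: "pair_sum (\<lambda>w. ?N $$ (u, w)) j =
      (sum_sum B (u div 2) j + (- 1) ^ u * pair_diff (\<lambda>x. pair_sum (\<lambda>y. B $$ (x, y)) j) (\<sigma> (u div 2))) / 2"
    if "j < n" for j
    unfolding pair_sum_def[of "\<lambda>w. ?N $$ (u, w)"] row_pair[OF that] sum_sum_def
    by (simp add: pair_sum_def pair_diff_def field_simps)
  have diff: "pair_diff (\<lambda>w. ?N $$ (u, w)) j =
      (sum_diff B (u div 2) j + (- 1) ^ u * diff_diff B (\<sigma> (u div 2)) j) / 2"
    if "j < n" for j
    unfolding pair_diff_def[of "\<lambda>w. ?N $$ (u, w)"] row_pair[OF that] sum_diff_def diff_diff_def
    by (simp add: pair_sum_def pair_diff_def field_simps)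
  have "(?N * ?P) $$ (u, v) =
    (sum_sum B (u div 2) (v div 2) + (- 1) ^ v * sum_diff B (u div 2) (\<sigma> (v div 2))
      + (- 1) ^ u * pair_diff (\<lambda>x. pair_sum (\<lambda>y. B $$ (x, y)) (v div 2)) (\<sigma> (u div 2))
      + (- 1) ^ u * (- 1) ^ v * diff_diff B (\<sigma> (u div 2)) (\<sigma> (v div 2))) / 4"
    unfolding mult_pair_perm_mat_index[of ?N "2 * n" n u v \<sigma>, OF N uv \<sigma>[OF lt(2)]]
      sum[OF lt(2)] diff[OF \<sigma>[OF lt(2)]]
    by (simp add: field_simps)
  then show ?thesis
    by (simp only: block_sums_symmetric(3)[OF B \<sigma>[OF lt(1)] lt(2)])
qed

lemma B_set_pair_perm_mat_iff:
  assumes B: "B \<in> carrier_mat (2 * n) (2 * n)" "adjacency_matrix B"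
    and \<sigma>: "\<And>i. i < n \<Longrightarrow> \<sigma> i < n"
  shows "B \<in> B_set (pair_perm_mat n \<sigma>) \<longleftrightarrow> switchable n (sum_sum B) (sum_diff B) (diff_diff B) \<sigma>"
proof -
  define C where "C = transpose_mat (pair_perm_mat n \<sigma>) * B * pair_perm_mat n \<sigma>"
  have C: "C \<in> carrier_mat (2 * n) (2 * n)"
    unfolding C_def using B by (intro mult_carrier_mat) auto
  have index: "C $$ (u, v) =
    (sum_sum B (u div 2) (v div 2) + (- 1) ^ v * sum_diff B (u div 2) (\<sigma> (v div 2))
      + (- 1) ^ u * sum_diff B (v div 2) (\<sigma> (u div 2))
      + (- 1) ^ u * (- 1) ^ v * diff_diff B (\<sigma> (u div 2)) (\<sigma> (v div 2))) / 4"
    if "u < 2 * n" "v < 2 * n" for u v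
    unfolding C_def using B \<sigma> that by (rule pair_perm_mat_conj_index)
  have sym: "C $$ (v, u) = C $$ (u, v)" if "u < 2 * n" "v < 2 * n" for u v
  proof -
    have "u div 2 < n" "v div 2 < n"
      using that by auto
    then show ?thesis
      unfolding index[OF that] index[OF that(2,1)]
      using block_sums_symmetric[OF B] \<sigma> by (simp add: algebra_simps)
  qed
  have entries: "(\<forall>u < 2 * n. \<forall>v < 2 * n. C $$ (u, v) \<in> {0, 1}) \<longleftrightarrow>
      (\<forall>i < n. \<forall>j < n. zero_one_block (sum_sum B i j) (sum_diff B i (\<sigma> j)) (sum_diff B j (\<sigma> i))
        (diff_diff B (\<sigma> i) (\<sigma> j)))"
  proof -
    have "(C $$ (2 * i, 2 * j) \<in> {0, 1} \<and> C $$ (2 * i, 2 * j + 1) \<in> {0, 1} \<and>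
        C $$ (2 * i + 1, 2 * j) \<in> {0, 1} \<and> C $$ (2 * i + 1, 2 * j + 1) \<in> {0, 1}) \<longleftrightarrow>
      zero_one_block (sum_sum B i j) (sum_diff B i (\<sigma> j)) (sum_diff B j (\<sigma> i))
        (diff_diff B (\<sigma> i) (\<sigma> j))" if "i < n" "j < n" for i j
    proof -
      have "2 * i < 2 * n" "2 * i + 1 < 2 * n" "2 * j < 2 * n" "2 * j + 1 < 2 * n"
        using that by auto
      note index = index[OF this(1,3)] index[OF this(1,4)] index[OF this(2,3)] index[OF this(2,4)]
      have quarter: "x / 4 \<in> {0, 1} \<longleftrightarrow> x \<in> {0, 4}" for x :: rat
        by auto
      have parity: "2 * k div 2 = k" "(2 * k + 1) div 2 = k"
        "(- 1) ^ (2 * k) = (1 :: rat)" "(- 1) ^ (2 * k + 1) = (- 1 :: rat)" for k :: nat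
        by (auto simp: power_mult)
      show ?thesis
        unfolding index quarter parity zero_one_block_def ball_simps simp_thms
        by (rule conj_assoc[symmetric])
    qed
    then show ?thesis
      unfolding all_less_double_iff by blast
  qed
  have diagonal: "(\<forall>u < 2 * n. C $$ (u, u) = 0) \<longleftrightarrow>
      (\<forall>i < n. sum_sum B i i + diff_diff B (\<sigma> i) (\<sigma> i) = 0 \<and> sum_diff B i (\<sigma> i) = 0)"
    unfolding all_less_double_iff
    by (intro all_cong) (auto simp: index power_add power_mult)
  have "B \<in> B_set (pair_perm_mat n \<sigma>) \<longleftrightarrow> adjacency_matrix C"
    using B by (simp add: B_set_def C_def)
  also have "\<dots> \<longleftrightarrow>
      (\<forall>u < 2 * n. \<forall>v < 2 * n. C $$ (u, v) \<in> {0, 1}) \<and> (\<forall>u < 2 * n. C $$ (u, u) = 0)"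
    unfolding adjacency_matrix_iff[OF C] by (intro arg_cong2[where f = conj] all_cong) (simp_all add: sym)
  also have "\<dots> \<longleftrightarrow> switchable n (sum_sum B) (sum_diff B) (diff_diff B) \<sigma>"
    unfolding entries diagonal switchable_def by (rule refl)
  finally show ?thesis .
qed

section \<open>\<open>R\<^sub>8\<close> as the matrix of a 4-cycle\<close>

definition cycle4 :: "nat \<Rightarrow> nat" where
  "cycle4 = transpose 0 1 \<circ> transpose 1 2 \<circ> transpose 2 3"

lemma cycle4_permutes: "cycle4 permutes {..<4}"
  unfolding cycle4_def by (intro permutes_compose permutes_swap_id) auto

lemma cycle4_simps [simp]:
  "cycle4 0 = 1" "cycle4 1 = 2" "cycle4 (Suc 0) = 2" "cycle4 2 = 3" "cycle4 3 = 0"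
  by (simp_all add: cycle4_def transpose_def)

lemma less_4_iff: "i < 4 \<longleftrightarrow> i \<in> {0, 1, 2, 3}" for i :: nat
  by auto

lemma all_less_4_iff: "(\<forall>i < 4. P i) \<longleftrightarrow> P 0 \<and> P 1 \<and> P 2 \<and> P 3" for P :: "nat \<Rightarrow> bool"
  by (auto simp: less_4_iff)

text \<open>On a pair, J is \<open>e e\<^sup>T\<close> and Y is \<open>f f\<^sup>T\<close>. Block
  column j of \<open>R\<^sub>8\<close> has J in block row j and Y in the cyclically next block row,
  so the vectors f move by \<open>0 -> 1 -> 2 -> 3 -> 0\<close>.\<close>

lemma R8_eq: "R8 = pair_perm_mat 4 cycle4"
proof (rule eq_matI)
  fix u v assume "u < dim_row (pair_perm_mat 4 cycle4)" "v < dim_col (pair_perm_mat 4 cycle4)"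
  then have "u \<in> {0, 1, 2, 3, 4, 5, 6, 7}" "v \<in> {0, 1, 2, 3, 4, 5, 6, 7}"
    by auto
  then show "R8 $$ (u, v) = pair_perm_mat 4 cycle4 $$ (u, v)"
    by (elim insertE; simp add: R8_def Let_def J2_def Y2_def pair_perm_mat_index)
qed (auto simp: R8_def Let_def J2_def Y2_def)

section \<open>Parity of the four signed sums of a 01-block\<close>

lemma zero_one_blockE:
  assumes "zero_one_block s c r t"
  obtains x y z w where "{x, y, z, w} \<subseteq> {0, 1}"
    "s = x + y + z + w" "c = x - y + z - w" "r = x + y - z - w" "t = x - y - z + w"
proof (rule that)
  \<comment> \<open>These are the entries of the block, row by row: the sign matrix of the four sums
    is a symmetric Hadamard matrix of order 4, so a quarter of it is its inverse.\<close>
  let ?x = "(s + c + r + t) / 4" and ?y = "(s - c + r - t) / 4"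
  let ?z = "(s + c - r - t) / 4" and ?w = "(s - c - r + t) / 4"
  show "{?x, ?y, ?z, ?w} \<subseteq> {0, 1}"
    using assms by (auto simp: zero_one_block_def)
  show "s = ?x + ?y + ?z + ?w" "c = ?x - ?y + ?z - ?w" "r = ?x + ?y - ?z - ?w" "t = ?x - ?y - ?z + ?w"
    by (simp_all add: field_simps)
qed

text \<open>Modulo 2 the signs disappear, so the four sums share one parity, and one even sum makes
  all of them even.\<close>

lemma zero_one_block_even:
  assumes "zero_one_block s c r t"
    and "s \<in> {0, 2, 4} \<or> c \<in> {- 2, 0, 2} \<or> r \<in> {- 2, 0, 2} \<or> t \<in> {- 2, 0, 2}"
  shows "s \<in> {0, 2, 4}" "c \<in> {- 2, 0, 2}" "r \<in> {- 2, 0, 2}" "t \<in> {- 2, 0, 2}"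
proof -
  from assms(1) obtain x y z w where "x = 0 \<or> x = 1" "y = 0 \<or> y = 1" "z = 0 \<or> z = 1" "w = 0 \<or> w = 1"
    and sums: "s = x + y + z + w" "c = x - y + z - w" "r = x + y - z - w" "t = x - y - z + w"
    by (elim zero_one_blockE) auto
  then have "s \<in> {0, 2, 4} \<and> c \<in> {- 2, 0, 2} \<and> r \<in> {- 2, 0, 2} \<and> t \<in> {- 2, 0, 2}"
    using assms(2) unfolding sums by (elim disjE[of "_ = 0" "_ = 1"]) simp_all
  then show "s \<in> {0, 2, 4}" "c \<in> {- 2, 0, 2}" "r \<in> {- 2, 0, 2}" "t \<in> {- 2, 0, 2}"
    by blast+
qed

text \<open>This describes 01-blocks with an even number of ones. Zero or four ones give
  \<open>c = r = t = 0\<close>. Two ones give \<open>s = 2\<close> and exactly one nonzero value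
  among the others: c if they share a column, r if they share a row, t if they lie on a
  diagonal.\<close>

definition half_block :: "rat \<Rightarrow> rat \<Rightarrow> rat \<Rightarrow> rat \<Rightarrow> bool" where
  "half_block s c r t \<longleftrightarrow>
    (s = 2 \<longleftrightarrow> \<not> (c = 0 \<and> r = 0 \<and> t = 0)) \<and> (c = 0 \<or> r = 0) \<and> (c = 0 \<or> t = 0) \<and> (r = 0 \<or> t = 0)"

text \<open>For even arguments the signs of \<open>c\<close>, \<open>r\<close>, \<open>t\<close> no longer matter.\<close>

lemma zero_one_block_iff_half_block:
  assumes even: "s \<in> {0, 2, 4}" "c \<in> {- 2, 0, 2}" "r \<in> {- 2, 0, 2}" "t \<in> {- 2, 0, 2}"
  shows "zero_one_block s c r t \<longleftrightarrow> half_block s c r t"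
proof
  assume "zero_one_block s c r t"
  then obtain x y z w where "x = 0 \<or> x = 1" "y = 0 \<or> y = 1" "z = 0 \<or> z = 1" "w = 0 \<or> w = 1"
    and "s = x + y + z + w" "c = x - y + z - w" "r = x + y - z - w" "t = x - y - z + w"
    by (elim zero_one_blockE) auto
  with even show "half_block s c r t"
    by (elim disjE) (simp_all add: half_block_def)
next
  assume half: "half_block s c r t"
  show "zero_one_block s c r t"
  proof (cases "s = 2")
    case True
    with half consider "c \<noteq> 0" "r = 0" "t = 0" | "c = 0" "r \<noteq> 0" "t = 0" | "c = 0" "r = 0" "t \<noteq> 0"
      unfolding half_block_def by blast
    then show ?thesis
      using True even by cases (auto simp: zero_one_block_def)
  next
    case False
    with half even show ?thesis
      by (auto simp: half_block_def zero_one_block_def)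
  qed
qed

section \<open>Existence of a suitable transposition\<close>

lemma switchable_transpose_exists:
  assumes sym: "\<And>i j. i < 4 \<Longrightarrow> j < 4 \<Longrightarrow> s i j = s j i" "\<And>i j. i < 4 \<Longrightarrow> j < 4 \<Longrightarrow> t i j = t j i"
    and id: "switchable 4 s c t id" and cyc: "switchable 4 s c t cycle4"
  shows "\<exists>(a, b) \<in> {(0, 1), (1, 2), (2, 3), (3, 0), (1, 3)}. switchable 4 s c t (transpose a b)"
proof -
  have cyc_lt: "cycle4 i < 4" if "i < 4" for i
    using that by (auto simp: less_4_iff)
  have diag: "c i i = 0" "t i i = - s i i" "c i (cycle4 i) = 0" "s i i + t (cycle4 i) (cycle4 i) = 0"
    if "i < 4" for i
    using id cyc that by (auto simp: switchable_def)
  \<comment> \<open>Comparing the diagonal conditions for the identity and for the 4-cycle shows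
    that s is constant on the diagonal. Hence the diagonal blocks stay admissible under any
    permutation \<sigma> with all \<open>c i (\<sigma> i) = 0\<close>.\<close>
  have "s i i = s (cycle4 i) (cycle4 i)" if "i < 4" for i
    using diag(2)[OF cyc_lt[OF that]] diag(4)[OF that] by simp
  from this[of 0] this[of 1] this[of 2] have s_diag: "s i i = s 0 0" if "i < 4" for i
    using that by (auto simp: less_4_iff)
  have blk_id: "zero_one_block (s i j) (c i j) (c j i) (t i j)" if "i < 4" "j < 4" for i j
    using id that by (simp add: switchable_def)
  have s0: "s 0 0 \<in> {0, 2}"
    using blk_id[of 0 0] diag(1,2)[of 0] by (auto simp: zero_one_block_def)
  have blk_cyc: "zero_one_block (s i j) (c i (cycle4 j)) (c j (cycle4 i)) (t (cycle4 i) (cycle4 j))"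
    if "i < 4" "j < 4" for i j
    using cyc that by (simp add: switchable_def)
  define even_pair where "even_pair i j \<longleftrightarrow>
    s i j \<in> {0, 2, 4} \<and> c i j \<in> {- 2, 0, 2} \<and> c j i \<in> {- 2, 0, 2} \<and> t i j \<in> {- 2, 0, 2}" for i j
  have even_sym: "even_pair j i" if "even_pair i j" "i < 4" "j < 4" for i j
    using that sym[of i j] by (simp add: even_pair_def)
  \<comment> \<open>The zero diagonal after switching gives \<open>c i (cycle4 i) = 0\<close>, an
    even value that makes its whole block even.\<close>
  have even1: "even_pair i (cycle4 i)" if "i < 4" for i
    using zero_one_block_even[OF blk_id[OF that cyc_lt[OF that]]] diag(3)[OF that]
    by (simp add: even_pair_def)
  \<comment> \<open>The switched block at \<open>(i, cycle4 i)\<close> keeps the even value s, so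
    its other sums are even too. One of them, \<open>c i (cycle4 (cycle4 i))\<close>, also belongs
    to the unswitched block two steps along the cycle.\<close>
  have even2: "even_pair i (cycle4 (cycle4 i))" if "i < 4" for i
  proof -
    have "c i (cycle4 (cycle4 i)) \<in> {- 2, 0, 2}"
      using zero_one_block_even(2)[OF blk_cyc[OF that cyc_lt[OF that]]] even1[OF that]
      unfolding even_pair_def by blast
    then show ?thesis
      using zero_one_block_even[OF blk_id[OF that cyc_lt[OF cyc_lt[OF that]]]]
      by (simp add: even_pair_def)
  qed
  \<comment> \<open>On a 4-cycle any two distinct points are one or two steps apart, so all
    off-diagonal blocks are even.\<close>
  have half: "even_pair 0 1" "even_pair 1 2" "even_pair 2 3" "even_pair 3 0" "even_pair 0 2" "even_pair 1 3"
    using even1[of 0] even1[of 1] even1[of 2] even1[of 3] even2[of 0] even2[of 1] by simp_all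
  from half[THEN even_sym] have "even_pair 1 0" "even_pair 2 1" "even_pair 3 2" "even_pair 0 3" "even_pair 2 0" "even_pair 3 1"
    by simp_all
  with half have even: "even_pair i j" if "i < 4" "j < 4" "i \<noteq> j" for i j
    using that unfolding less_4_iff by blast
  have even_c: "c i j \<in> {- 2, 0, 2}" if "i < 4" "j < 4" for i j
    using even[OF that] diag(1)[of i] that by (cases "i = j") (auto simp: even_pair_def)
  define good where "good i j \<sigma> \<longleftrightarrow> half_block (s i j) (c i (\<sigma> j)) (c j (\<sigma> i)) (t (\<sigma> i) (\<sigma> j))"
    for i j \<sigma>
  have switchable_iff: "switchable 4 s c t \<sigma> \<longleftrightarrow> (\<forall>i < 4. c i (\<sigma> i) = 0) \<and>
      good 0 1 \<sigma> \<and> good 0 2 \<sigma> \<and> good 0 3 \<sigma> \<and> good 1 2 \<sigma> \<and> good 1 3 \<sigma> \<and> good 2 3 \<sigma>"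
    if \<sigma>: "\<sigma> permutes {..<4}" for \<sigma>
  proof -
    have lt: "\<sigma> i < 4" if "i < 4" for i
      using permutes_in_image[OF \<sigma>, of i] that by simp
    have off: "zero_one_block (s i j) (c i (\<sigma> j)) (c j (\<sigma> i)) (t (\<sigma> i) (\<sigma> j)) \<longleftrightarrow> good i j \<sigma>"
      if "i < 4" "j < 4" "i \<noteq> j" for i j
    proof -
      have "\<sigma> i \<noteq> \<sigma> j"
        using permutes_inj[OF \<sigma>] that by (auto dest: injD)
      then show ?thesis
        unfolding good_def
        using even[OF that] even[of "\<sigma> i" "\<sigma> j"] even_c[of i "\<sigma> j"] even_c[of j "\<sigma> i"] lt that
        by (intro zero_one_block_iff_half_block) (auto simp: even_pair_def)
    qed
    have good_sym: "good j i \<sigma> \<longleftrightarrow> good i j \<sigma>" if "i < 4" "j < 4" for i j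
      using sym(1)[OF that] sym(2)[OF lt[OF that(1)] lt[OF that(2)]]
      by (auto simp: good_def half_block_def)
    have on: "zero_one_block (s i i) 0 0 (t (\<sigma> i) (\<sigma> i)) \<and> s i i + t (\<sigma> i) (\<sigma> i) = 0" if "i < 4" for i
      using s0 s_diag[OF that] s_diag[OF lt[OF that]] diag(2)[OF lt[OF that]]
      by (auto simp: zero_one_block_def)
    have "switchable 4 s c t \<sigma> \<longleftrightarrow> (\<forall>i < 4. c i (\<sigma> i) = 0) \<and>
        (\<forall>i < 4. \<forall>j < 4. i \<noteq> j \<longrightarrow> good i j \<sigma>)"
      unfolding switchable_def using off on by metis
    also have "(\<forall>i < 4. \<forall>j < 4. i \<noteq> j \<longrightarrow> good i j \<sigma>) \<longleftrightarrow>
        good 0 1 \<sigma> \<and> good 0 2 \<sigma> \<and> good 0 3 \<sigma> \<and> good 1 2 \<sigma> \<and> good 1 3 \<sigma> \<and> good 2 3 \<sigma>"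
      unfolding all_less_4_iff
      using good_sym[of 0 1] good_sym[of 0 2] good_sym[of 0 3] good_sym[of 1 2] good_sym[of 1 3]
        good_sym[of 2 3]
      by auto
    finally show ?thesis .
  qed
  have t_sym: "t 1 0 = t 0 1" "t 2 0 = t 0 2" "t 3 0 = t 0 3" "t 2 1 = t 1 2" "t 3 1 = t 1 3" "t 3 2 = t 2 3"
    by (simp_all add: sym(2))
  have c_diag: "c 0 0 = 0" "c 1 1 = 0" "c 2 2 = 0" "c 3 3 = 0"
    by (simp_all add: diag)
  have perms: "transpose 0 1 permutes {..<4::nat}" "transpose 1 2 permutes {..<4::nat}"
    "transpose 2 3 permutes {..<4::nat}" "transpose 3 0 permutes {..<4::nat}"
    "transpose 1 3 permutes {..<4::nat}"
    by (auto intro: permutes_swap_id)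
  have perm_values: "cycle4 0 = 1" "cycle4 1 = 2" "cycle4 2 = 3" "cycle4 3 = 0"
    "transpose 0 1 (0 :: nat) = 1" "transpose 0 1 (1 :: nat) = 0"
    "transpose 0 1 (2 :: nat) = 2" "transpose 0 1 (3 :: nat) = 3"
    "transpose 1 2 (0 :: nat) = 0" "transpose 1 2 (1 :: nat) = 2"
    "transpose 1 2 (2 :: nat) = 1" "transpose 1 2 (3 :: nat) = 3"
    "transpose 2 3 (0 :: nat) = 0" "transpose 2 3 (1 :: nat) = 1"
    "transpose 2 3 (2 :: nat) = 3" "transpose 2 3 (3 :: nat) = 2"
    "transpose 3 0 (0 :: nat) = 3" "transpose 3 0 (1 :: nat) = 1"
    "transpose 3 0 (2 :: nat) = 2" "transpose 3 0 (3 :: nat) = 0"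
    "transpose 1 3 (0 :: nat) = 0" "transpose 1 3 (1 :: nat) = 3"
    "transpose 1 3 (2 :: nat) = 2" "transpose 1 3 (3 :: nat) = 1"
    by (simp_all add: transpose_def)
  note id' = id[unfolded switchable_iff[OF permutes_id] good_def all_less_4_iff half_block_def
      id_apply t_sym c_diag]
  note cyc' = cyc[unfolded switchable_iff[OF cycle4_permutes] good_def all_less_4_iff half_block_def
      perm_values t_sym c_diag]
  \<comment> \<open>After evaluating the permutations, the atoms are whether s equals 2 and whether
    c and t vanish. \<open>t_sym\<close> makes both orientations of t share an atom, and what
    remains is a propositional tautology.\<close>
  have "switchable 4 s c t (transpose 0 1) \<or> switchable 4 s c t (transpose 1 2) \<or>
    switchable 4 s c t (transpose 2 3) \<or> switchable 4 s c t (transpose 3 0) \<or>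
    switchable 4 s c t (transpose 1 3)"
    using id' cyc'
    unfolding switchable_iff[OF perms(1)] switchable_iff[OF perms(2)] switchable_iff[OF perms(3)]
      switchable_iff[OF perms(4)] switchable_iff[OF perms(5)]
      good_def all_less_4_iff half_block_def perm_values t_sym c_diag
    by satx
  then show ?thesis
    by auto
qed

section \<open>Bordered adjacency matrices and the admissible border columns\<close>

lemma adjacency_matrix_four_block_iff:
  assumes carrier: "X \<in> carrier_mat n n" "Y \<in> carrier_mat n m" "W \<in> carrier_mat m m"
  shows "adjacency_matrix (four_block_mat X Y (transpose_mat Y) W) \<longleftrightarrow>
    adjacency_matrix X \<and> adjacency_matrix W \<and> (\<forall>i < n. \<forall>j < m. Y $$ (i, j) \<in> {0, 1})"
    (is "adjacency_matrix ?A \<longleftrightarrow> _")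
proof -
  have A: "?A \<in> carrier_mat (n + m) (n + m)"
    using carrier by auto
  have all_sum: "(\<forall>i < n + m. P i) \<longleftrightarrow> (\<forall>i < n. P i) \<and> (\<forall>i < m. P (n + i))" for P :: "nat \<Rightarrow> bool"
    by (metis add_diff_inverse_nat nat_add_left_cancel_less trans_less_add1)
  show ?thesis
    unfolding adjacency_matrix_iff[OF A] adjacency_matrix_iff[OF carrier(1)]
      adjacency_matrix_iff[OF carrier(3)] all_sum
    using carrier by auto
qed

text \<open>Conjugation replaces B by \<open>P\<^sup>T B P\<close> and the border V by
  \<open>P\<^sup>T V\<close>, and leaves W alone. The new border is a 01-matrix because the columns
  of V lie in \<open>V_set P\<close>.\<close>

lemma adjacency_matrix_extend_id_conj:
  assumes carrier: "P \<in> carrier_mat n n" "B \<in> carrier_mat n n" "V \<in> carrier_mat n m" "W \<in> carrier_mat m m"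
    and A: "adjacency_matrix (four_block_mat B V (transpose_mat V) W)"
    and B: "adjacency_matrix (transpose_mat P * B * P)" and V: "set (cols V) \<subseteq> V_set P"
  shows "adjacency_matrix (transpose_mat (extend_id m P) *
    four_block_mat B V (transpose_mat V) W * extend_id m P)"
proof -
  let ?Z = "transpose_mat P * V"
  have Q: "extend_id m P = four_block_mat P (0\<^sub>m n m) (0\<^sub>m m n) (1\<^sub>m m)"
    using carrier by (simp add: extend_id_def)
  have QT: "transpose_mat (extend_id m P) = four_block_mat (transpose_mat P) (0\<^sub>m n m) (0\<^sub>m m n) (1\<^sub>m m)"
    unfolding Q using carrier by (subst transpose_four_block_mat) auto
  have "transpose_mat (extend_id m P) * four_block_mat B V (transpose_mat V) W =
      four_block_mat (transpose_mat P * B) ?Z (transpose_mat V) W"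
    unfolding QT using carrier by (subst mult_four_block_mat) auto
  also have "\<dots> * extend_id m P = four_block_mat (transpose_mat P * B * P) ?Z (transpose_mat V * P) W"
    unfolding Q using carrier by (subst mult_four_block_mat) auto
  also have "transpose_mat V * P = transpose_mat ?Z"
    using carrier by (subst transpose_mult) auto
  finally have conj: "transpose_mat (extend_id m P) * four_block_mat B V (transpose_mat V) W *
    extend_id m P = four_block_mat (transpose_mat P * B * P) ?Z (transpose_mat ?Z) W" .
  have "?Z $$ (i, j) \<in> {0, 1}" if "i < n" "j < m" for i j
  proof -
    have "col V j \<in> V_set P"
      using V carrier that by (auto simp: cols_def)
    then have "set\<^sub>v (transpose_mat P *\<^sub>v col V j) \<subseteq> {0, 1}"
      by (simp add: V_set_def)
    moreover have "(transpose_mat P *\<^sub>v col V j) $ i \<in> set\<^sub>v (transpose_mat P *\<^sub>v col V j)"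
      unfolding vec_set_def using carrier that by (intro imageI) simp
    ultimately have "(transpose_mat P *\<^sub>v col V j) $ i \<in> {0, 1}"
      by blast
    then show ?thesis
      using carrier that by simp
  qed
  moreover have "adjacency_matrix W"
    using A adjacency_matrix_four_block_iff[OF carrier(2-4)] by simp
  moreover have "transpose_mat P * B * P \<in> carrier_mat n n" "?Z \<in> carrier_mat n m"
    using carrier by auto
  ultimately show ?thesis
    unfolding conj using B carrier(4) by (subst adjacency_matrix_four_block_iff) blast+
qed

text \<open>The 4-cycle is transitive, so its parity condition makes all four pair sums equally odd
  or even, a property that every \<sigma> respects.\<close>

lemma V_set_R8_subset:
  assumes \<sigma>: "\<sigma> permutes {..<4}"
  shows "V_set R8 \<subseteq> V_set (pair_perm_mat 4 \<sigma>)"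
proof
  fix v assume v: "v \<in> V_set R8"
  then have v01: "v \<in> carrier_vec (2 * 4)" "set\<^sub>v v \<subseteq> {0, 1}"
    by (simp_all add: V_set_def R8_eq)
  have lt: "cycle4 i < 4" "\<sigma> i < 4" if "i < 4" for i
    using permutes_in_image[OF cycle4_permutes, of i] permutes_in_image[OF \<sigma>, of i] that by auto
  define q where "q i \<longleftrightarrow> pair_sum (($) v) i = 1" for i
  have "\<forall>i < 4. q i \<longleftrightarrow> q (cycle4 i)"
    using v V_set_pair_perm_mat_iff[OF v01 lt(1)] by (simp add: R8_eq q_def)
  then have "q 0 \<longleftrightarrow> q 1" "q 1 \<longleftrightarrow> q 2" "q 2 \<longleftrightarrow> q 3"
    unfolding all_less_4_iff cycle4_simps by blast+
  then have "q i \<longleftrightarrow> q 0" if "i < 4" for i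
    using that unfolding less_4_iff by blast
  then have "\<forall>i < 4. q i \<longleftrightarrow> q (\<sigma> i)"
    using lt(2) by blast
  then show "v \<in> V_set (pair_perm_mat 4 \<sigma>)"
    using V_set_pair_perm_mat_iff[OF v01 lt(2)] by (simp add: q_def)
qed

section \<open>Indecomposability and level of \<open>R\<^sub>8\<close>\<close>

lemma decomposable_nonzero_entries_split:
  assumes "decomposable M"
  obtains S T where "S \<subset> {..<dim_row M}" "S \<noteq> {}"
    "\<And>i j. i < dim_row M \<Longrightarrow> j < dim_row M \<Longrightarrow> M $$ (i, j) \<noteq> 0 \<Longrightarrow> i \<in> S \<longleftrightarrow> j \<in> T"
proof -
  let ?n = "dim_row M"
  obtain p q k C D where p: "p permutes {..<?n}" and q: "q permutes {..<?n}" and k: "0 < k" "k < ?n"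
    and CD: "C \<in> carrier_mat k k" "D \<in> carrier_mat (?n - k) (?n - k)"
    and M: "mat ?n ?n (\<lambda>(i, j). M $$ (p i, q j)) =
      four_block_mat C (0\<^sub>m k (?n - k)) (0\<^sub>m (?n - k) k) D"
    using assms unfolding decomposable_def by blast
  have zero: "M $$ (p i, q j) = 0" if "i < ?n" "j < ?n" "i < k \<longleftrightarrow> \<not> j < k" for i j
  proof -
    have "M $$ (p i, q j) = mat ?n ?n (\<lambda>(i, j). M $$ (p i, q j)) $$ (i, j)"
      using that by simp
    also have "\<dots> = 0"
      unfolding M using that CD k by auto
    finally show ?thesis .
  qed
  have inj: "inj p" "inj q"
    using p q by (auto intro: permutes_inj)
  show thesis
  proof (rule that)
    have "p ` {..<k} \<subset> p ` {..<?n}"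
      using k inj by (auto simp: inj_image_subset_iff psubset_eq inj_image_eq_iff)
    then show "p ` {..<k} \<subset> {..<?n}"
      by (simp add: permutes_image[OF p])
    show "p ` {..<k} \<noteq> {}"
      using k by auto
    fix i j assume ij: "i < ?n" "j < ?n" "M $$ (i, j) \<noteq> 0"
    then obtain i' j' where "i = p i'" "j = q j'" "i' < ?n" "j' < ?n"
      using permutes_image[OF p] permutes_image[OF q] by (metis imageE lessThan_iff)
    then show "i \<in> p ` {..<k} \<longleftrightarrow> j \<in> q ` {..<k}"
      using zero ij(3) by (auto simp: inj_image_mem_iff[OF inj(1)] inj_image_mem_iff[OF inj(2)])
  qed
qed

text \<open>A decomposition would disconnect the bipartite graph that joins a row to a column at
  each nonzero entry. For \<open>R\<^sub>8\<close> this graph links all rows.\<close>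

lemma not_decomposable_R8: "\<not> decomposable R8"
proof
  assume "decomposable R8"
  then obtain S T where S: "S \<subset> {..<8}" "S \<noteq> {}"
    and split: "\<And>i j. i < 8 \<Longrightarrow> j < 8 \<Longrightarrow> pair_perm_mat 4 cycle4 $$ (i, j) \<noteq> 0 \<Longrightarrow> i \<in> S \<longleftrightarrow> j \<in> T"
    by (elim decomposable_nonzero_entries_split) (auto simp: R8_eq)
  \<comment> \<open>Where the cycle moves \<open>j div 2\<close>, the two terms of an entry cannot
    both be present, so they cannot cancel.\<close>
  have split': "i \<in> S \<longleftrightarrow> j \<in> T"
    if "i < 8" "j < 8" "i div 2 = j div 2 \<or> i div 2 = cycle4 (j div 2)" "cycle4 (j div 2) \<noteq> j div 2" for i j
    using that by (intro split) (auto simp: pair_perm_mat_index)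
  \<comment> \<open>Columns 0, 2 and 4 suffice: column 0 links rows 0 to 3, column 2 links rows 2,
    4, 5, and column 4 links rows 4, 6, 7.\<close>
  have "0 \<in> S \<longleftrightarrow> 0 \<in> T" "1 \<in> S \<longleftrightarrow> 0 \<in> T" "2 \<in> S \<longleftrightarrow> 0 \<in> T" "3 \<in> S \<longleftrightarrow> 0 \<in> T"
    "2 \<in> S \<longleftrightarrow> 2 \<in> T" "4 \<in> S \<longleftrightarrow> 2 \<in> T" "5 \<in> S \<longleftrightarrow> 2 \<in> T"
    "4 \<in> S \<longleftrightarrow> 4 \<in> T" "6 \<in> S \<longleftrightarrow> 4 \<in> T" "7 \<in> S \<longleftrightarrow> 4 \<in> T"
    by (simp_all add: split')
  then have "i \<in> S \<longleftrightarrow> 0 \<in> S" if "i \<in> {0, 1, 2, 3, 4, 5, 6, 7}" for i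
    using that by blast
  moreover have "{..<8} = {0, 1, 2, 3, 4, 5, 6, 7 :: nat}"
    by auto
  ultimately show False
    using S by blast
qed

lemma level_R8: "level R8 = 2"
  unfolding level_def
proof (rule Least_equality)
  show "(2 :: nat) > 0 \<and> elements_mat (of_nat 2 \<cdot>\<^sub>m R8) \<subseteq> \<int>"
    using elements_double_pair_perm_mat[of 4 cycle4] by (simp add: R8_eq)
  fix l :: nat assume l: "l > 0 \<and> elements_mat (of_nat l \<cdot>\<^sub>m R8) \<subseteq> \<int>"
  have "(of_nat 1 \<cdot>\<^sub>m R8) $$ (0, 0) = 1 / 2"
    by (simp add: R8_eq pair_perm_mat_index)
  moreover have "(of_nat 1 \<cdot>\<^sub>m R8) $$ (0, 0) \<in> elements_mat (of_nat 1 \<cdot>\<^sub>m R8)"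
    by (rule elements_matI[of _ 8 8 0 0]) (auto simp: R8_eq)
  moreover have "(1 / 2 :: rat) \<notin> \<int>"
  proof
    assume "(1 / 2 :: rat) \<in> \<int>"
    then obtain k :: int where "(1 / 2 :: rat) = of_int k"
      by (elim Ints_cases)
    then have "(of_int (2 * k) :: rat) = of_int 1"
      by simp
    then have "2 * k = 1"
      by (simp only: of_int_eq_iff)
    then show False
      by presburger
  qed
  ultimately have "l \<noteq> 1"
    using l by (metis subsetD)
  then show "2 \<le> l"
    using l by simp
qed

section \<open>The factorization of \<open>R\<^sub>8\<close> into two decomposable factors\<close>

theorem theorem21:
  fixes B :: "rat mat"
  assumes "B \<in> B_set R8"
  shows "reducible R8 B"
proof -
  have R8_dim: "dim_row R8 = 8"
    by (simp add: R8_eq)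
  have B: "B \<in> carrier_mat (2 * 4) (2 * 4)" "adjacency_matrix B"
    using assms by (simp_all add: B_set_def R8_eq)
  have lt: "\<sigma> i < 4" if "\<sigma> permutes {..<4}" "i < 4" for \<sigma> and i :: nat
    using permutes_in_image[OF that(1), of i] that(2) by simp
  have B_set_iff: "B \<in> B_set (pair_perm_mat 4 \<sigma>) \<longleftrightarrow>
      switchable 4 (sum_sum B) (sum_diff B) (diff_diff B) \<sigma>" if "\<sigma> permutes {..<4}" for \<sigma>
    using B lt[OF that] by (rule B_set_pair_perm_mat_iff)
  \<comment> \<open>Since the matrix of \<open>id\<close> is the identity matrix, this expresses in
    block sums that B itself is an adjacency matrix.\<close>
  have "B \<in> B_set (pair_perm_mat 4 id)"
    using B by (simp add: B_set_def pair_perm_mat_id)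
  then have "switchable 4 (sum_sum B) (sum_diff B) (diff_diff B) id"
    by (simp only: B_set_iff[OF permutes_id])
  moreover have "switchable 4 (sum_sum B) (sum_diff B) (diff_diff B) cycle4"
    using B_set_iff[OF cycle4_permutes] assms by (simp add: R8_eq)
  ultimately obtain a b where ab: "(a, b) \<in> {(0, 1), (1, 2), (2, 3), (3, 0), (1, 3)}"
    and switch: "switchable 4 (sum_sum B) (sum_diff B) (diff_diff B) (transpose a b)"
    using switchable_transpose_exists[of "sum_sum B" "diff_diff B" "sum_diff B"]
      block_sums_symmetric(1,2)[OF B] by blast
  define \<sigma> where "\<sigma> = transpose a b"
  define \<tau> where "\<tau> = \<sigma> \<circ> cycle4"
  have \<sigma>: "\<sigma> permutes {..<4}"
    unfolding \<sigma>_def using ab by (intro permutes_swap_id) auto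
  have \<tau>: "\<tau> permutes {..<4}"
    unfolding \<tau>_def by (rule permutes_compose[OF cycle4_permutes \<sigma>])
  let ?R1 = "pair_perm_mat 4 \<sigma>" and ?R2 = "pair_perm_mat 4 \<tau>"
  have "\<sigma> \<circ> \<tau> = cycle4"
    by (simp add: \<tau>_def \<sigma>_def fun_eq_iff)
  then have R8_prod: "R8 = mat_prod 8 [?R1, ?R2]"
    using lt[OF \<tau>] by (simp add: R8_eq mat_prod_def right_mult_one_mat' pair_perm_mat_mult)
  have B_R1: "adjacency_matrix (transpose_mat ?R1 * B * ?R1)"
    using B_set_iff[OF \<sigma>] switch by (simp add: \<sigma>_def B_set_def)
  have a: "a < 4"
    using ab by auto
  have decomp_R1: "decomposable ?R1"
    using \<sigma> a by (rule decomposable_pair_perm_mat_if_two_cycle) (simp_all add: \<sigma>_def)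
  \<comment> \<open>If a and b are neighbours on the cycle, \<tau> fixes a; for the pair (1, 3),
    \<tau> swaps 0 and 3.\<close>
  have "\<tau> (\<tau> a) = a \<or> \<tau> (\<tau> 0) = 0"
    using ab by (elim insertE emptyE; simp add: \<tau>_def \<sigma>_def transpose_def)
  then have decomp_R2: "decomposable ?R2"
    using decomposable_pair_perm_mat_if_two_cycle[OF \<tau>, of a]
      decomposable_pair_perm_mat_if_two_cycle[OF \<tau>, of 0] a by auto
  \<comment> \<open>With two factors, the only partial product to check is the first factor
    alone.\<close>
  have "adjacency_matrix (transpose_mat (mat_prod (8 + m) [extend_id m ?R1]) *
      four_block_mat B V (transpose_mat V) W * mat_prod (8 + m) [extend_id m ?R1])"
    if "V \<in> carrier_mat 8 m" "W \<in> carrier_mat m m"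
      "adjacency_matrix (four_block_mat B V (transpose_mat V) W)" "set (cols V) \<subseteq> V_set R8" for m V W
  proof -
    have "mat_prod (8 + m) [extend_id m ?R1] = extend_id m ?R1"
      by (simp add: mat_prod_def extend_id_def right_mult_one_mat')
    moreover have "?R1 \<in> carrier_mat 8 8" "B \<in> carrier_mat 8 8"
      using B pair_perm_mat_carrier[of 4 \<sigma>] by simp_all
    moreover have "set (cols V) \<subseteq> V_set ?R1"
      using that(4) V_set_R8_subset[OF \<sigma>] by (rule subset_trans)
    ultimately show ?thesis
      using adjacency_matrix_extend_id_conj[OF _ _ that(1-3) B_R1] by (simp only:)
  qed
  then have reduce: "\<forall>i \<in> {1..<length [?R1, ?R2]}. \<forall>m. \<forall>V \<in> carrier_mat 8 m. \<forall>W \<in> carrier_mat m m.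
      let A = four_block_mat B V (transpose_mat V) W;
          Q = mat_prod (8 + m) (map (extend_id m) (take i [?R1, ?R2]))
      in adjacency_matrix A \<and> set (cols V) \<subseteq> V_set R8 \<longrightarrow> adjacency_matrix (transpose_mat Q * A * Q)"
    by (simp add: Let_def)
  have factors: "\<forall>R' \<in> set [?R1, ?R2]. R' \<in> carrier_mat 8 8 \<and>
      regular_orthogonal R' \<and> decomposable R' \<and> level R' \<le> 2"
    using pair_perm_mat_carrier[of 4] regular_orthogonal_pair_perm_mat[OF \<sigma>]
      regular_orthogonal_pair_perm_mat[OF \<tau>] decomp_R1 decomp_R2
    by (simp add: level_pair_perm_mat_le)
  have "regular_orthogonal R8"
    by (simp add: R8_eq regular_orthogonal_pair_perm_mat cycle4_permutes)
  then show ?thesis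
    unfolding reducible_def R8_dim using assms not_decomposable_R8 level_R8
    by (intro conjI exI[of _ "[?R1, ?R2]"] factors R8_prod reduce)
qed

end
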